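(* Let $n=8$ or $n=16$. The following operations on $n\times n$ Franklin squares are symmetry operations: (i) rotating the square by 90 degrees; (ii) reflecting the square across one of its edges; (iii) transposing the square; (iv) interchanging columns (respectively, rows) $i$ and $i+2$, where $1\le i\le (n/2)-2$ or $(n/2)+1\le i\le n-2$; (v) interchanging the first $n/2$ columns (respectively, rows) of the square with the last $n/2$ columns (respectively, rows) simultaneously (i.e. interchanging column (row) $j$ with column (row) $j+n/2$ for all $1\le j\le n/2$); (vi) interchanging all the adjacent columns (respectively, rows) $i$ and $i+1$, for all $i=1,3,5,\dots,n-1$, simultaneously. Moreover, the following operations are additional symmetry operations on $16\times 16$ Franklin squares: interchanging columns (respectively, rows) $i$ and $i+4$, where $1\le i\le 4$ or $9\le i\le 12$.
   Context: Let $n\in\{8,16\}$. An $n\times n$ Franklin square is an $n\times n$ matrix $(y_{ij})_{1\le i,j\le n}$ with nonnegative integer entries (not required to be distinct) for which there is a number $s$ (the magic sum) such that: (1) every row and every column sums to $s$; (2) every half-row (the first $n/2$ or the last $n/2$ entries of a row) and every half-column (the first $n/2$ or the last $n/2$ entries of a column) sums to $s/2$; (3) every bent diagonal sums to $s$; (4) every $2\times 2$ subsquare of adjacent cells, including those that wrap around the edges (the square viewed as a torus), sums to $4s/n$ (that is, $s/2$ for $n=8$ and $s/4$ for $n=16$). The bent diagonals are the following $4n$ sets of $n$ cells (row indices, resp. column indices, taken modulo $n$; $k=0,\dots,n-1$): $\{(k+j,\,j):1\le j\le n/2\}\cup\{(k+n+1-j,\,j): n/2<j\le n\}$; $\{(k+n+1-j,\,j):1\le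 j\le n/2\}\cup\{(k+j,\,j): n/2<j\le n\}$; and the transposes of these sets (obtained by exchanging row and column coordinates). A permutation of the entries (cell positions) of $n\times n$ squares is called a symmetry operation if it maps the set of all $n\times n$ Franklin squares to itself. *)

theory Defs
  imports Complex_Main "HOL-Library.FuncSet" "HOL-Combinatorics.Transposition"
begin

definition cells :: "nat \<Rightarrow> (nat \<times> nat) set" where
  "cells n = {1..n} \<times> {1..n}"

text \<open>The representative in \<open>{1..n}\<close> of an index taken modulo \<open>n\<close>.\<close>

definition wrap :: "nat \<Rightarrow> nat \<Rightarrow> nat" where
  "wrap n m = (if m mod n = 0 then n else m mod n)"

definition bent_diag1 :: "nat \<Rightarrow> nat \<Rightarrow> (nat \<times> nat) set" where
  "bent_diag1 n k =
     {(wrap n (k + j), j) | j. 1 \<le> j \<and> j \<le> n div 2} \<union>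
     {(wrap n (k + n + 1 - j), j) | j. n div 2 < j \<and> j \<le> n}"

definition bent_diag2 :: "nat \<Rightarrow> nat \<Rightarrow> (nat \<times> nat) set" where
  "bent_diag2 n k =
     {(wrap n (k + n + 1 - j), j) | j. 1 \<le> j \<and> j \<le> n div 2} \<union>
     {(wrap n (k + j), j) | j. n div 2 < j \<and> j \<le> n}"

definition bent_diagonals :: "nat \<Rightarrow> (nat \<times> nat) set set" where
  "bent_diagonals n =
     (\<Union>k\<in>{0..<n}. {bent_diag1 n k, bent_diag2 n k,
                     prod.swap ` bent_diag1 n k, prod.swap ` bent_diag2 n k})"

definition cell_sum :: "(nat \<times> nat \<Rightarrow> nat) \<Rightarrow> (nat \<times> nat) set \<Rightarrow> real" where
  "cell_sum y A = real (\<Sum>c\<in>A. y c)"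

text \<open>A square assigns to each cell (row, column) its entry; being \<open>extensional\<close>, it is
  determined by its values on \<open>cells n\<close>.\<close>

definition franklin_squares :: "nat \<Rightarrow> (nat \<times> nat \<Rightarrow> nat) set" where
  "franklin_squares n = {y \<in> extensional (cells n). \<exists>s::real.
     (\<forall>i\<in>{1..n}. cell_sum y ({i} \<times> {1..n}) = s \<and> cell_sum y ({1..n} \<times> {i}) = s) \<and>
     (\<forall>i\<in>{1..n}. cell_sum y ({i} \<times> {1..n div 2}) = s / 2 \<and>
                 cell_sum y ({i} \<times> {n div 2 + 1..n}) = s / 2 \<and>
                 cell_sum y ({1..n div 2} \<times> {i}) = s / 2 \<and>
                 cell_sum y ({n div 2 + 1..n} \<times> {i}) = s / 2) \<and>
     (\<forall>D\<in>bent_diagonals n. cell_sum y D = s) \<and>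
     (\<forall>i\<in>{1..n}. \<forall>j\<in>{1..n}.
        cell_sum y ({i, wrap n (i + 1)} \<times> {j, wrap n (j + 1)}) = 4 * s / real n)}"

text \<open>The operation given by a permutation \<open>p\<close> of the cells puts into cell \<open>c\<close> the entry
  previously found in cell \<open>p c\<close>.\<close>

definition permute_entries ::
    "nat \<Rightarrow> (nat \<times> nat \<Rightarrow> nat \<times> nat) \<Rightarrow> (nat \<times> nat \<Rightarrow> nat) \<Rightarrow> (nat \<times> nat \<Rightarrow> nat)" where
  "permute_entries n p y = restrict (y \<circ> p) (cells n)"

definition symmetry_operation :: "nat \<Rightarrow> (nat \<times> nat \<Rightarrow> nat \<times> nat) \<Rightarrow> bool" where
  "symmetry_operation n p \<longleftrightarrow>
     bij_betw p (cells n) (cells n) \<and>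
     permute_entries n p ` franklin_squares n = franklin_squares n"

definition on_columns :: "(nat \<Rightarrow> nat) \<Rightarrow> nat \<times> nat \<Rightarrow> nat \<times> nat" where
  "on_columns f = (\<lambda>(i, j). (i, f j))"

definition on_rows :: "(nat \<Rightarrow> nat) \<Rightarrow> nat \<times> nat \<Rightarrow> nat \<times> nat" where
  "on_rows f = (\<lambda>(i, j). (f i, j))"

text \<open>Rows are numbered from top to bottom, so the new entry in cell \<open>(i, j)\<close> after a clockwise
  quarter turn is the old entry in cell \<open>(n + 1 - j, i)\<close>.\<close>

definition rotate_cw :: "nat \<Rightarrow> nat \<times> nat \<Rightarrow> nat \<times> nat" where
  "rotate_cw n = (\<lambda>(i, j). (n + 1 - j, i))"

definition rotate_ccw :: "nat \<Rightarrow> nat \<times> nat \<Rightarrow> nat \<times> nat" where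
  "rotate_ccw n = (\<lambda>(i, j). (j, n + 1 - i))"

definition reverse_index :: "nat \<Rightarrow> nat \<Rightarrow> nat" where
  "reverse_index n j = n + 1 - j"

definition swap_halves :: "nat \<Rightarrow> nat \<Rightarrow> nat" where
  "swap_halves n j = (if j \<le> n div 2 then j + n div 2 else j - n div 2)"

definition swap_adjacent :: "nat \<Rightarrow> nat" where
  "swap_adjacent j = (if odd j then j + 1 else j - 1)"

end

theory Submission
  imports Defs
begin

text \<open>A torus with an even side has all adjacent \<open>2 \<times> 2\<close> sums equal to \<open>4 s / n\<close> iff its entries are
  \<open>y(i, j) = s / n + (-1)^(i + j) (a i + b j)\<close>. In these coordinates the contribution of \<open>a\<close> to
  a bent diagonal through all columns cancels, and the conditions on half-rows and on these
  diagonals say just that \<open>b\<close> has vanishing alternating sum on each half of the index range and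
  equal sums on the two halves; transposition exchanges the roles of \<open>a\<close> and \<open>b\<close>. A permutation
  of the columns that respects the partition into halves and the partition by parity preserves
  these conditions on \<open>b\<close>; if it exchanges the parities, both \<open>a\<close> and \<open>b\<close> change sign.\<close>

section \<open>Composition of symmetry operations, and the case of involutions\<close>

lemma symmetry_operation_comp:
  assumes "symmetry_operation n p" "symmetry_operation n q"
  shows "symmetry_operation n (p \<circ> q)"
proof -
  have q: "bij_betw q (cells n) (cells n)"
    using assms(2) by (simp add: symmetry_operation_def)
  \<comment> \<open>Entries are pulled back along the permutation, so composition is contravariant
    and \<open>p\<close> acts first. The intermediate restriction is invisible because
    \<open>q\<close> sends cells to cells.\<close>
  have "permute_entries n (p \<circ> q) = permute_entries n q \<circ> permute_entries n p"
    using bij_betwE[OF q] by (fastforce simp: permute_entries_def restrict_def)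
  then show ?thesis
    using assms bij_betw_trans[OF q, of p "cells n"]
    by (simp add: symmetry_operation_def image_comp[symmetric] del: o_apply image_image)
qed

text \<open>For an involution one inclusion is enough: a Franklin square is the image of its own
  image, which is again a Franklin square.\<close>

lemma symmetry_operation_involution:
  assumes maps: "\<And>c. c \<in> cells n \<Longrightarrow> p c \<in> cells n"
    and inv: "\<And>c. c \<in> cells n \<Longrightarrow> p (p c) = c"
    and franklin: "\<And>y. y \<in> franklin_squares n \<Longrightarrow> permute_entries n p y \<in> franklin_squares n"
  shows "symmetry_operation n p"
proof -
  have "bij_betw p (cells n) (cells n)"
    by (rule bij_betw_byWitness[where f' = p]) (use maps inv in auto)
  moreover have "y \<in> permute_entries n p ` franklin_squares n" if y: "y \<in> franklin_squares n" for y
  proof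
    have "y \<in> extensional (cells n)"
      using y by (simp add: franklin_squares_def)
    then show "y = permute_entries n p (permute_entries n p y)"
      using maps inv by (auto simp: permute_entries_def extensional_def)
  qed (rule franklin[OF y])
  ultimately show ?thesis
    using franklin by (auto simp: symmetry_operation_def)
qed

section \<open>Indices modulo \<open>n\<close> and alternating signs\<close>

lemma wrap_in: "n > 0 \<Longrightarrow> wrap n m \<in> {1..n}"
  using mod_less_divisor[of n m] by (auto simp: wrap_def simp del: mod_less_divisor)

lemma wrap_eq_self: "m \<in> {1..n} \<Longrightarrow> wrap n m = m"
  by (cases "m = n") (auto simp: wrap_def)

lemma even_wrap: "even n \<Longrightarrow> even (wrap n m) \<longleftrightarrow> even m"
  by (auto simp: wrap_def dvd_mod_iff)

text \<open>Consecutive signs cancel in pairs, so the induction goes down by two. This is what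
  removes \<open>a\<close> from the half-row sums.\<close>

lemma sum_uminus_one_power_even_interval:
  "even h \<Longrightarrow> (\<Sum>j = m + 1..m + h. (- 1) ^ j) = (0 :: 'a :: comm_ring_1)"
proof (induction h rule: nat_less_induct)
  case (1 h)
  show ?case
  proof (cases "h = 0")
    case False
    with 1 obtain g where "h = Suc (Suc g)" "even g"
      by (metis even_Suc not0_implies_Suc odd_one One_nat_def)
    then show ?thesis using 1 by simp
  qed simp
qed

section \<open>Additive coordinates of a square\<close>

definition decomposes :: "nat \<Rightarrow> (nat \<times> nat \<Rightarrow> nat) \<Rightarrow> real \<Rightarrow> (nat \<Rightarrow> real) \<Rightarrow> (nat \<Rightarrow> real) \<Rightarrow> bool" where
  "decomposes n y s a b \<longleftrightarrow>
     (\<forall>i\<in>{1..n}. \<forall>j\<in>{1..n}. real (y (i, j)) = s / real n + (- 1) ^ (i + j) * (a i + b j))"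

text \<open>The first two equations come from the half-rows, the third from the bent diagonals. A
  decomposition fixes \<open>a\<close> and \<open>b\<close> only up to adding a constant to one and
  subtracting it from the other; for even \<open>h\<close> such a shift does not affect these
  equations.\<close>

definition balanced :: "nat \<Rightarrow> (nat \<Rightarrow> real) \<Rightarrow> bool" where
  "balanced h b \<longleftrightarrow>
     (\<Sum>j = 1..h. (- 1) ^ j * b j) = 0 \<and> (\<Sum>j = h + 1..2 * h. (- 1) ^ j * b j) = 0 \<and>
     (\<Sum>j = 1..h. b j) = (\<Sum>j = h + 1..2 * h. b j)"

text \<open>Collects the conditions on sets that meet every column at most once. Those on columns
  and transposed diagonals are the same conditions for \<open>y \<circ> prod.swap\<close>, so only
  one kind has to be analysed.\<close>

definition row_conditions :: "nat \<Rightarrow> (nat \<times> nat \<Rightarrow> nat) \<Rightarrow> real \<Rightarrow> bool" where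
  "row_conditions n y s \<longleftrightarrow>
     (\<forall>i\<in>{1..n}. cell_sum y ({i} \<times> {1..n}) = s \<and> cell_sum y ({i} \<times> {1..n div 2}) = s / 2 \<and>
                 cell_sum y ({i} \<times> {n div 2 + 1..n}) = s / 2) \<and>
     (\<forall>k\<in>{0..<n}. cell_sum y (bent_diag1 n k) = s \<and> cell_sum y (bent_diag2 n k) = s)"

definition square_conditions :: "nat \<Rightarrow> (nat \<times> nat \<Rightarrow> nat) \<Rightarrow> real \<Rightarrow> bool" where
  "square_conditions n y s \<longleftrightarrow>
     (\<forall>i\<in>{1..n}. \<forall>j\<in>{1..n}.
        cell_sum y ({i, wrap n (i + 1)} \<times> {j, wrap n (j + 1)}) = 4 * s / real n)"

lemma decomposes_swap: "decomposes n y s a b \<Longrightarrow> decomposes n (y \<circ> prod.swap) s b a"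
  by (simp add: decomposes_def add.commute)

lemma cell_sum_swap: "cell_sum y (prod.swap ` A) = cell_sum (y \<circ> prod.swap) A"
  by (simp add: cell_sum_def sum.reindex)

lemma cell_sum_column: "cell_sum y (A \<times> {i}) = cell_sum (y \<circ> prod.swap) ({i} \<times> A)"
proof -
  have "A \<times> {i} = prod.swap ` ({i} \<times> A)"
    by (auto simp: image_iff)
  then show ?thesis
    by (simp only: cell_sum_swap)
qed

lemma franklin_squares_iff_conditions:
  "y \<in> franklin_squares n \<longleftrightarrow> y \<in> extensional (cells n) \<and>
     (\<exists>s. row_conditions n y s \<and> row_conditions n (y \<circ> prod.swap) s \<and> square_conditions n y s)"
  unfolding franklin_squares_def row_conditions_def square_conditions_def bent_diagonals_def
    mem_Collect_eq cell_sum_column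
  by (simp add: cell_sum_swap ball_conj_distrib conj_ac)

section \<open>Adjacent 2 by 2 squares\<close>

lemma cell_sum_row: "cell_sum y ({i} \<times> J) = (\<Sum>j\<in>J. real (y (i, j)))"
proof -
  have "{i} \<times> J = Pair i ` J" by auto
  then show ?thesis
    by (simp add: cell_sum_def sum.reindex inj_on_def)
qed

lemma cell_sum_rectangle:
  "i \<noteq> i' \<Longrightarrow> j \<noteq> j' \<Longrightarrow>
   cell_sum y ({i, i'} \<times> {j, j'}) =
     real (y (i, j)) + real (y (i, j')) + real (y (i', j)) + real (y (i', j'))"
  unfolding cell_sum_def sum.cartesian_product'[symmetric] by simp

text \<open>In a 2 by 2 square each of the values of \<open>a\<close> and \<open>b\<close> involved
  occurs twice, with opposite signs. Evenness of \<open>n\<close> makes the signs alternate also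
  across the edge, from index \<open>n\<close> to index \<open>1\<close>.\<close>

lemma square_conditions_if_decomposes:
  assumes "even n" "n > 0" "decomposes n y s a b"
  shows "square_conditions n y s"
proof -
  have "cell_sum y ({i, wrap n (i + 1)} \<times> {j, wrap n (j + 1)}) = 4 * s / real n"
    if ij: "i \<in> {1..n}" "j \<in> {1..n}" for i j
  proof -
    define i' j' where "i' = wrap n (i + 1)" and "j' = wrap n (j + 1)"
    have mem: "i' \<in> {1..n}" "j' \<in> {1..n}"
      using wrap_in \<open>n > 0\<close> by (simp_all add: i'_def j'_def del: atLeastAtMost_iff)
    have parity: "even i' \<longleftrightarrow> odd i" "even j' \<longleftrightarrow> odd j"
      by (simp_all add: i'_def j'_def even_wrap[OF \<open>even n\<close>])
    then have "i \<noteq> i'" "j \<noteq> j'" by auto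
    then have "cell_sum y ({i, i'} \<times> {j, j'}) =
        real (y (i, j)) + real (y (i, j')) + real (y (i', j)) + real (y (i', j'))"
      by (rule cell_sum_rectangle)
    also have "\<dots> = 4 * s / real n"
      using assms(3) ij mem parity
      by (cases "even i"; cases "even j") (simp_all add: decomposes_def power_add)
    finally show ?thesis by (simp add: i'_def j'_def)
  qed
  then show ?thesis by (simp add: square_conditions_def)
qed

lemma decomposes_if_square_conditions:
  assumes n: "n > 0" and squares: "square_conditions n y s"
  shows "\<exists>a b. decomposes n y s a b"
proof -
  \<comment> \<open>Subtracting the mean and removing the checkerboard sign turns the 2 by 2
    condition into a vanishing mixed second difference of \<open>w\<close>; hence \<open>w\<close>
    is a function of the row plus a function of the column.\<close>
  define w where "w i j = (- 1) ^ (i + j) * (real (y (i, j)) - s / real n)" for i j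
  have corner: "w (Suc i) (Suc j) = w (Suc i) j + w i (Suc j) - w i j"
    if "1 \<le> i" "i < n" "1 \<le> j" "j < n" for i j
  proof -
    have "cell_sum y ({i, wrap n (i + 1)} \<times> {j, wrap n (j + 1)}) = 4 * s / real n"
      using squares that by (simp add: square_conditions_def)
    moreover have "wrap n (i + 1) = Suc i" "wrap n (j + 1) = Suc j"
      using that by (simp_all add: wrap_eq_self)
    ultimately have "real (y (i, j)) + real (y (i, Suc j)) + real (y (Suc i, j)) +
        real (y (Suc i, Suc j)) = 4 * (s / real n)"
      using cell_sum_rectangle[of i "Suc i" j "Suc j" y] by simp
    then show ?thesis
      by (cases "even (i + j)") (auto simp: w_def algebra_simps)
  qed
  \<comment> \<open>The difference of two adjacent rows is constant along the columns; summing these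
    differences down column \<open>j\<close> then gives \<open>additive\<close>.\<close>
  have rows: "w (Suc i) j - w i j = w (Suc i) 1 - w i 1" if "1 \<le> i" "i < n" "1 \<le> j" "j \<le> n" for i j
    using that(3,4)
  proof (induction j rule: dec_induct)
    case (step j)
    then show ?case using corner[of i j] that by simp
  qed simp
  have additive: "w i j = w i 1 + (w 1 j - w 1 1)" if "1 \<le> i" "i \<le> n" "1 \<le> j" "j \<le> n" for i j
    using that(1,2)
  proof (induction i rule: dec_induct)
    case (step i)
    then show ?case using rows[of i j] that by simp
  qed simp
  have entry: "real (y (i, j)) = s / real n + (- 1) ^ (i + j) * w i j" for i j
    by (simp add: w_def mult.assoc[symmetric] power_add[symmetric])
  \<comment> \<open>The witnesses are the first column and the first row of \<open>w\<close>, with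
    the shared corner \<open>w 1 1\<close> counted once.\<close>
  have "decomposes n y s (\<lambda>i. w i 1) (\<lambda>j. w 1 j - w 1 1)"
    unfolding decomposes_def by (intro ballI, subst entry, subst additive) simp_all
  then show ?thesis by blast
qed

section \<open>Sums over half-rows and bent diagonals\<close>

lemma cell_sum_bent_diag1:
  "cell_sum y (bent_diag1 (2 * h) k) =
     (\<Sum>j = 1..h. real (y (wrap (2 * h) (k + j), j))) +
     (\<Sum>j = h + 1..2 * h. real (y (wrap (2 * h) (k + 2 * h + 1 - j), j)))"
proof -
  have "bent_diag1 (2 * h) k =
      (\<lambda>j. (wrap (2 * h) (k + j), j)) ` {1..h} \<union>
      (\<lambda>j. (wrap (2 * h) (k + 2 * h + 1 - j), j)) ` {h + 1..2 * h}"
    by (auto simp: bent_diag1_def)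
  \<comment> \<open>The two arms lie in disjoint sets of columns, and within an arm the column
    determines the cell, so the sum splits and can be indexed by columns.\<close>
  then show ?thesis
    by (simp add: cell_sum_def, subst sum.union_disjoint)
      (auto simp: sum.reindex inj_on_def)
qed

lemma cell_sum_bent_diag2:
  "cell_sum y (bent_diag2 (2 * h) k) =
     (\<Sum>j = 1..h. real (y (wrap (2 * h) (k + 2 * h + 1 - j), j))) +
     (\<Sum>j = h + 1..2 * h. real (y (wrap (2 * h) (k + j), j)))"
proof -
  have "bent_diag2 (2 * h) k =
      (\<lambda>j. (wrap (2 * h) (k + 2 * h + 1 - j), j)) ` {1..h} \<union>
      (\<lambda>j. (wrap (2 * h) (k + j), j)) ` {h + 1..2 * h}"
    by (auto simp: bent_diag2_def)
  then show ?thesis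
    by (simp add: cell_sum_def, subst sum.union_disjoint)
      (auto simp: sum.reindex inj_on_def)
qed

text \<open>Along a row \<open>a i\<close> is constant and is multiplied by an alternating sum of
  even length, which vanishes. The offset \<open>m\<close> serves for both halves.\<close>

lemma decomposes_cell_sum_half_row:
  assumes "decomposes n y s a b" "even h" "i \<in> {1..n}" "m + h \<le> n"
  shows "cell_sum y ({i} \<times> {m + 1..m + h}) =
    real h * s / real n + (- 1) ^ i * (\<Sum>j = m + 1..m + h. (- 1) ^ j * b j)"
proof -
  have "cell_sum y ({i} \<times> {m + 1..m + h}) =
      (\<Sum>j = m + 1..m + h. s / real n + (- 1) ^ i * (a i * (- 1) ^ j + (- 1) ^ j * b j))"
    using assms unfolding cell_sum_row
    by (intro sum.cong refl) (auto simp: decomposes_def power_add algebra_simps)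
  also have "\<dots> = real h * s / real n +
      (- 1) ^ i * (a i * (\<Sum>j = m + 1..m + h. (- 1) ^ j) + (\<Sum>j = m + 1..m + h. (- 1) ^ j * b j))"
    by (simp add: sum.distrib sum_distrib_left[symmetric] del: add_Suc_right)
  finally show ?thesis
    using sum_uminus_one_power_even_interval[OF \<open>even h\<close>, of m, where 'a = real] by simp
qed

text \<open>Row and column index grow together, so their sum keeps the parity of \<open>k\<close>
  and all signs on the arm agree.\<close>

lemma decomposes_sum_ascending:
  assumes "decomposes n y s a b" "even n" "J \<subseteq> {1..n}"
  shows "(\<Sum>j\<in>J. real (y (wrap n (k + j), j))) =
    real (card J) * s / real n + (- 1) ^ k * ((\<Sum>j\<in>J. a (wrap n (k + j))) + (\<Sum>j\<in>J. b j))"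
proof -
  have "real (y (wrap n (k + j), j)) = s / real n + (- 1) ^ k * (a (wrap n (k + j)) + b j)"
    if "j \<in> J" for j
  proof -
    have "j \<in> {1..n}" "wrap n (k + j) \<in> {1..n}"
      using that assms(3) wrap_in[of n "k + j"] by auto
    then have "real (y (wrap n (k + j), j)) =
        s / real n + (- 1) ^ (wrap n (k + j) + j) * (a (wrap n (k + j)) + b j)"
      using assms(1) by (simp add: decomposes_def)
    moreover have "even (wrap n (k + j) + j) \<longleftrightarrow> even k"
      using even_wrap[OF assms(2), of "k + j"] by auto
    ultimately show ?thesis
      by (auto simp: uminus_power_if)
  qed
  then show ?thesis
    by (simp add: sum.distrib sum_distrib_left[symmetric])
qed

text \<open>Row and column index add up to \<open>k + n + 1\<close> modulo \<open>n\<close>, whose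
  parity is opposite to that of \<open>k\<close>; hence the common sign is opposite to that of an
  ascending arm.\<close>

lemma decomposes_sum_descending:
  assumes "decomposes n y s a b" "even n" "J \<subseteq> {1..n}"
  shows "(\<Sum>j\<in>J. real (y (wrap n (k + n + 1 - j), j))) =
    real (card J) * s / real n -
    (- 1) ^ k * ((\<Sum>j\<in>J. a (wrap n (k + n + 1 - j))) + (\<Sum>j\<in>J. b j))"
proof -
  have "real (y (wrap n (k + n + 1 - j), j)) =
      s / real n - (- 1) ^ k * (a (wrap n (k + n + 1 - j)) + b j)"
    if "j \<in> J" for j
  proof -
    have j: "j \<in> {1..n}" "wrap n (k + n + 1 - j) \<in> {1..n}"
      using that assms(3) wrap_in[of n "k + n + 1 - j"] by auto
    then have "real (y (wrap n (k + n + 1 - j), j)) =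
        s / real n + (- 1) ^ (wrap n (k + n + 1 - j) + j) * (a (wrap n (k + n + 1 - j)) + b j)"
      using assms(1) by (simp add: decomposes_def)
    moreover have "even (wrap n (k + n + 1 - j) + j) \<longleftrightarrow> odd k"
      using even_wrap[OF assms(2), of "k + n + 1 - j"] j assms(2) by auto
    ultimately show ?thesis
      by (auto simp: uminus_power_if)
  qed
  then show ?thesis
    by (simp add: sum.distrib sum_subtractf sum_distrib_left[symmetric])
qed

lemma decomposes_cell_sum_bent_diag:
  assumes "decomposes (2 * h) y s a b" "h > 0"
  shows "cell_sum y (bent_diag1 (2 * h) k) =
      s + (- 1) ^ k * ((\<Sum>j = 1..h. b j) - (\<Sum>j = h + 1..2 * h. b j))" (is ?thesis1)
    and "cell_sum y (bent_diag2 (2 * h) k) =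
      s - (- 1) ^ k * ((\<Sum>j = 1..h. b j) - (\<Sum>j = h + 1..2 * h. b j))" (is ?thesis2)
proof -
  have sub: "{1..h} \<subseteq> {1..2 * h}" "{h + 1..2 * h} \<subseteq> {1..2 * h}" by auto
  \<comment> \<open>The reflection \<open>j \<mapsto> 2 * h + 1 - j\<close> shows that both arms
    pass through the same rows. Their signs are opposite, so \<open>a\<close> cancels and only the
    difference of the half sums of \<open>b\<close> remains.\<close>
  have "(\<Sum>j = h + 1..2 * h. a (wrap (2 * h) (k + 2 * h + 1 - j))) =
      (\<Sum>j = 1..h. a (wrap (2 * h) (k + j)))"
    by (rule sum.reindex_bij_witness[of _ "\<lambda>j. 2 * h + 1 - j" "\<lambda>j. 2 * h + 1 - j"]) auto
  then show ?thesis1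
    using \<open>h > 0\<close>
    by (simp only: cell_sum_bent_diag1 decomposes_sum_ascending[OF assms(1) _ sub(1)]
        decomposes_sum_descending[OF assms(1) _ sub(2)] dvd_triv_left)
      (simp add: algebra_simps)
  have "(\<Sum>j = 1..h. a (wrap (2 * h) (k + 2 * h + 1 - j))) =
      (\<Sum>j = h + 1..2 * h. a (wrap (2 * h) (k + j)))"
    by (rule sum.reindex_bij_witness[of _ "\<lambda>j. 2 * h + 1 - j" "\<lambda>j. 2 * h + 1 - j"]) auto
  then show ?thesis2
    using \<open>h > 0\<close>
    by (simp only: cell_sum_bent_diag2 decomposes_sum_ascending[OF assms(1) _ sub(2)]
        decomposes_sum_descending[OF assms(1) _ sub(1)] dvd_triv_left)
      (simp add: algebra_simps)
qed

section \<open>Franklin squares in terms of the coordinates\<close>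

lemma row_conditions_iff_balanced:
  assumes dec: "decomposes (2 * h) y s a b" and h: "h > 0" "even h"
  shows "row_conditions (2 * h) y s \<longleftrightarrow> balanced h b"
proof -
  have halves:
    "cell_sum y ({i} \<times> {1..h}) = s / 2 + (- 1) ^ i * (\<Sum>j = 1..h. (- 1) ^ j * b j)"
    "cell_sum y ({i} \<times> {h + 1..2 * h}) = s / 2 + (- 1) ^ i * (\<Sum>j = h + 1..2 * h. (- 1) ^ j * b j)"
    if "i \<in> {1..2 * h}" for i
    \<comment> \<open>The offsets \<open>0\<close> and \<open>h\<close> give the left and the right
      half.\<close>
    using decomposes_cell_sum_half_row[OF dec h(2) that, of 0]
      decomposes_cell_sum_half_row[OF dec h(2) that, of h] h(1)
    unfolding mult_2[symmetric] by simp_all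
  have full: "cell_sum y ({i} \<times> {1..2 * h}) =
      cell_sum y ({i} \<times> {1..h}) + cell_sum y ({i} \<times> {h + 1..2 * h})" for i
  proof -
    have "{1..2 * h} = {1..h} \<union> {h + 1..2 * h}" by auto
    then show ?thesis
      unfolding cell_sum_row by (simp only:) (rule sum.union_disjoint, auto)
  qed
  show ?thesis
  proof
    assume "row_conditions (2 * h) y s"
    \<comment> \<open>The indices \<open>i\<close> and \<open>k\<close> enter the deviations from
      \<open>s / 2\<close> and \<open>s\<close> only through a sign, so row \<open>1\<close> and the
      diagonal with \<open>k = 0\<close> yield all three equations.\<close>
    then have "cell_sum y ({1} \<times> {1..h}) = s / 2" "cell_sum y ({1} \<times> {h + 1..2 * h}) = s / 2"
      "cell_sum y (bent_diag1 (2 * h) 0) = s"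
      using h(1) by (auto simp: row_conditions_def)
    then show "balanced h b"
      using halves[of 1] decomposes_cell_sum_bent_diag(1)[OF dec h(1), of 0] h(1)
      by (simp add: balanced_def)
  next
    assume bal: "balanced h b"
    then have "cell_sum y ({i} \<times> {1..h}) = s / 2" "cell_sum y ({i} \<times> {h + 1..2 * h}) = s / 2"
      "cell_sum y ({i} \<times> {1..2 * h}) = s" if "i \<in> {1..2 * h}" for i
      using halves[OF that] full[of i] by (simp_all add: balanced_def)
    then show "row_conditions (2 * h) y s"
      using bal decomposes_cell_sum_bent_diag[OF dec h(1)]
      by (simp add: row_conditions_def balanced_def)
  qed
qed

text \<open>The row criterion holds for every decomposition, so the one obtained from the 2 by 2
  squares can be used twice: for \<open>y\<close> it gives the condition on \<open>b\<close>, and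
  for the transpose, where the coordinates are exchanged, the condition on \<open>a\<close>.\<close>

lemma franklin_squares_iff_balanced:
  assumes "h > 0" "even h"
  shows "y \<in> franklin_squares (2 * h) \<longleftrightarrow> y \<in> extensional (cells (2 * h)) \<and>
    (\<exists>s a b. decomposes (2 * h) y s a b \<and> balanced h a \<and> balanced h b)"
proof -
  have pos: "2 * h > 0" using assms(1) by simp
  note row_iff = row_conditions_iff_balanced[OF _ assms]
  have "(row_conditions (2 * h) y s \<and> row_conditions (2 * h) (y \<circ> prod.swap) s \<and>
      square_conditions (2 * h) y s) \<longleftrightarrow>
    (\<exists>a b. decomposes (2 * h) y s a b \<and> balanced h a \<and> balanced h b)" for s
  proof (intro iffI; elim conjE exE)
    assume rows: "row_conditions (2 * h) y s" "row_conditions (2 * h) (y \<circ> prod.swap) s"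
      and "square_conditions (2 * h) y s"
    then obtain a b where dec: "decomposes (2 * h) y s a b"
      using decomposes_if_square_conditions[OF pos] by blast
    then show "\<exists>a b. decomposes (2 * h) y s a b \<and> balanced h a \<and> balanced h b"
      using rows row_iff[OF dec] row_iff[OF decomposes_swap[OF dec]] by blast
  next
    fix a b assume dec: "decomposes (2 * h) y s a b" and "balanced h a" "balanced h b"
    then show "row_conditions (2 * h) y s \<and> row_conditions (2 * h) (y \<circ> prod.swap) s \<and>
        square_conditions (2 * h) y s"
      using row_iff[OF dec] row_iff[OF decomposes_swap[OF dec]]
        square_conditions_if_decomposes[OF dvd_triv_left pos dec] by blast
  qed
  then show ?thesis
    by (simp add: franklin_squares_iff_conditions)
qed

section \<open>Transposition and involutions of the columns or rows\<close>

lemma symmetry_operation_swap: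
  assumes "h > 0" "even h"
  shows "symmetry_operation (2 * h) prod.swap"
proof (rule symmetry_operation_involution)
  fix y assume "y \<in> franklin_squares (2 * h)"
  then obtain s a b where "decomposes (2 * h) y s a b" "balanced h a" "balanced h b"
    using franklin_squares_iff_balanced[OF assms] by blast
  moreover from this(1) have "decomposes (2 * h) (permute_entries (2 * h) prod.swap y) s b a"
    by (auto simp: decomposes_def permute_entries_def cells_def add.commute)
  ultimately show "permute_entries (2 * h) prod.swap y \<in> franklin_squares (2 * h)"
    unfolding franklin_squares_iff_balanced[OF assms] by (auto simp: permute_entries_def)
qed (auto simp: cells_def)

text \<open>Inclusions suffice as \<open>f\<close> will be an involution, which turns them into
  bijections between the halves.\<close>

definition respects_halves :: "nat \<Rightarrow> (nat \<Rightarrow> nat) \<Rightarrow> bool" where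
  "respects_halves h f \<longleftrightarrow>
     f ` {1..h} \<subseteq> {1..h} \<and> f ` {h + 1..2 * h} \<subseteq> {h + 1..2 * h} \<or>
     f ` {1..h} \<subseteq> {h + 1..2 * h} \<and> f ` {h + 1..2 * h} \<subseteq> {1..h}"

definition respects_parity :: "nat \<Rightarrow> (nat \<Rightarrow> nat) \<Rightarrow> bool" where
  "respects_parity n f \<longleftrightarrow>
     (\<forall>j\<in>{1..n}. even (f j) \<longleftrightarrow> even j) \<or> (\<forall>j\<in>{1..n}. even (f j) \<longleftrightarrow> odd j)"

lemma balanced_cmult: "balanced h b \<Longrightarrow> balanced h (\<lambda>j. c * b j)"
  by (simp add: balanced_def mult.left_commute[of _ c] sum_distrib_left[symmetric])

text \<open>Reindexing by \<open>f\<close> permutes the half sums and multiplies the alternating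
  ones by \<open>e\<close>. The latter stay zero, and equality of the two half sums is symmetric in
  the halves.\<close>

lemma balanced_permute:
  assumes bal: "balanced h b" and halves: "respects_halves h f"
    and inv: "\<And>j. j \<in> {1..2 * h} \<Longrightarrow> f (f j) = j"
    and sign: "\<And>j. j \<in> {1..2 * h} \<Longrightarrow> (- 1) ^ f j = e * (- 1 :: real) ^ j"
    and e: "e * e = 1"
  shows "balanced h (b \<circ> f)"
proof -
  \<comment> \<open>Here \<open>J\<close> is a half and \<open>K\<close> the half to which
    \<open>f\<close> sends it.\<close>
  have plain: "(\<Sum>j\<in>J. b (f j)) = (\<Sum>j\<in>K. b j)"
    and alternating: "(\<Sum>j\<in>J. (- 1) ^ j * b (f j)) = e * (\<Sum>j\<in>K. (- 1) ^ j * b j)"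
    if "f ` J \<subseteq> K" "f ` K \<subseteq> J" "J \<subseteq> {1..2 * h}" "K \<subseteq> {1..2 * h}" for J K
  proof -
    have bij: "bij_betw f J K"
      by (rule bij_betw_byWitness[where f' = f]) (use that inv in auto)
    show "(\<Sum>j\<in>J. b (f j)) = (\<Sum>j\<in>K. b j)"
      by (rule sum.reindex_bij_betw[OF bij])
    have "(- 1) ^ j * b (f j) = e * ((- 1) ^ f j * b (f j))" if "j \<in> J" for j
      using sign[of j] that \<open>J \<subseteq> _\<close> e by (auto simp: mult.assoc[symmetric])
    then have "(\<Sum>j\<in>J. (- 1) ^ j * b (f j)) = e * (\<Sum>j\<in>J. (- 1) ^ f j * b (f j))"
      by (simp only: sum_distrib_left cong: sum.cong)
    then show "(\<Sum>j\<in>J. (- 1) ^ j * b (f j)) = e * (\<Sum>j\<in>K. (- 1) ^ j * b j)"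
      by (simp only: sum.reindex_bij_betw[OF bij, of "\<lambda>j. (- 1) ^ j * b j"])
  qed
  have sub: "{1..h} \<subseteq> {1..2 * h}" "{h + 1..2 * h} \<subseteq> {1..2 * h}" by auto
  from halves show ?thesis
    unfolding respects_halves_def
  proof (elim disjE conjE)
    assume "f ` {1..h} \<subseteq> {1..h}" "f ` {h + 1..2 * h} \<subseteq> {h + 1..2 * h}"
    then show ?thesis
      using bal plain[OF _ _ sub(1) sub(1)] plain[OF _ _ sub(2) sub(2)]
        alternating[OF _ _ sub(1) sub(1)] alternating[OF _ _ sub(2) sub(2)]
      by (simp add: balanced_def)
  next
    assume "f ` {1..h} \<subseteq> {h + 1..2 * h}" "f ` {h + 1..2 * h} \<subseteq> {1..h}"
    then show ?thesis
      using bal plain[OF _ _ sub] plain[OF _ _ sub(2) sub(1)]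
        alternating[OF _ _ sub] alternating[OF _ _ sub(2) sub(1)]
      by (simp add: balanced_def)
  qed
qed

text \<open>With \<open>e\<close> the sign by which \<open>f\<close> changes parity, the new square
  has the coordinates \<open>e * a i\<close> and \<open>e * b (f j)\<close> and the same
  \<open>s\<close>.\<close>

lemma symmetry_operation_on_columns:
  assumes h: "h > 0" "even h" and halves: "respects_halves h f"
    and parity: "respects_parity (2 * h) f"
    and inv: "\<And>j. j \<in> {1..2 * h} \<Longrightarrow> f (f j) = j"
  shows "symmetry_operation (2 * h) (on_columns f)"
proof -
  have maps: "f j \<in> {1..2 * h}" if "j \<in> {1..2 * h}" for j
  proof -
    have "j \<in> {1..h} \<or> j \<in> {h + 1..2 * h}" using that by auto
    then have "f j \<in> {1..h} \<union> {h + 1..2 * h}"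
      using halves unfolding respects_halves_def by blast
    then show ?thesis by auto
  qed
  obtain e :: real where e: "e * e = 1"
    and sign: "\<And>j. j \<in> {1..2 * h} \<Longrightarrow> (- 1) ^ f j = e * (- 1) ^ j"
  proof -
    from parity show ?thesis
      unfolding respects_parity_def
    proof
      assume "\<forall>j\<in>{1..2 * h}. even (f j) \<longleftrightarrow> even j"
      then show ?thesis by (intro that[of 1]) (auto simp: uminus_power_if)
    next
      assume "\<forall>j\<in>{1..2 * h}. even (f j) \<longleftrightarrow> odd j"
      then show ?thesis by (intro that[of "- 1"]) (auto simp: uminus_power_if)
    qed
  qed
  show ?thesis
  proof (rule symmetry_operation_involution)
    fix y assume "y \<in> franklin_squares (2 * h)"
    then obtain s a b where dec: "decomposes (2 * h) y s a b" and bal: "balanced h a" "balanced h b"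
      using franklin_squares_iff_balanced[OF h] by blast
    have "decomposes (2 * h) (permute_entries (2 * h) (on_columns f) y) s
        (\<lambda>i. e * a i) (\<lambda>j. e * (b \<circ> f) j)"
      unfolding decomposes_def
    proof (intro ballI)
      fix i j assume ij: "i \<in> {1..2 * h}" "j \<in> {1..2 * h}"
      then have "real (permute_entries (2 * h) (on_columns f) y (i, j)) = real (y (i, f j))"
        by (simp add: permute_entries_def on_columns_def cells_def)
      also have "\<dots> = s / real (2 * h) + (- 1) ^ (i + f j) * (a i + b (f j))"
        using dec ij(1) maps[OF ij(2)] by (simp add: decomposes_def)
      finally show "real (permute_entries (2 * h) (on_columns f) y (i, j)) =
          s / real (2 * h) + (- 1) ^ (i + j) * (e * a i + e * (b \<circ> f) j)"
        using sign[OF ij(2)] by (simp add: power_add algebra_simps)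
    qed
    moreover have "balanced h (\<lambda>i. e * a i)" "balanced h (\<lambda>j. e * (b \<circ> f) j)"
      by (intro balanced_cmult bal balanced_permute[OF bal(2) halves inv sign e]; assumption)+
    ultimately show "permute_entries (2 * h) (on_columns f) y \<in> franklin_squares (2 * h)"
      unfolding franklin_squares_iff_balanced[OF h] by (auto simp: permute_entries_def)
  qed (use maps inv in \<open>auto simp: on_columns_def cells_def\<close>)
qed

text \<open>A row operation is the column operation conjugated by transposition.\<close>

lemma symmetry_operation_on_rows:
  assumes "h > 0" "even h" "symmetry_operation (2 * h) (on_columns f)"
  shows "symmetry_operation (2 * h) (on_rows f)"
proof -
  have "on_rows f = prod.swap \<circ> (on_columns f \<circ> prod.swap)"
    by (auto simp: on_rows_def on_columns_def)
  then show ?thesis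
    using assms symmetry_operation_comp symmetry_operation_swap by metis
qed

section \<open>The individual operations\<close>

lemma symmetry_operation_on_columns_reverse:
  assumes "h > 0" "even h"
  shows "symmetry_operation (2 * h) (on_columns (reverse_index (2 * h)))"
proof (rule symmetry_operation_on_columns[OF assms])
  \<comment> \<open>Reversal exchanges the halves and, \<open>2 * h + 1\<close> being odd, also the
    parities.\<close>
  show "respects_halves h (reverse_index (2 * h))"
    unfolding respects_halves_def reverse_index_def by (rule disjI2) auto
  show "respects_parity (2 * h) (reverse_index (2 * h))"
    unfolding respects_parity_def reverse_index_def by (rule disjI2) auto
qed (auto simp: reverse_index_def)

text \<open>A quarter turn is not an involution, but it is the composition of a reflection and the
  transposition; the opposite turn composes them in the other order.\<close>

lemma symmetry_operation_rotate_cw: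
  assumes "h > 0" "even h"
  shows "symmetry_operation (2 * h) (rotate_cw (2 * h))"
proof -
  have "rotate_cw (2 * h) = on_rows (reverse_index (2 * h)) \<circ> prod.swap"
    by (auto simp: rotate_cw_def on_rows_def reverse_index_def)
  then show ?thesis
    using assms symmetry_operation_comp symmetry_operation_swap symmetry_operation_on_rows
      symmetry_operation_on_columns_reverse by metis
qed

lemma symmetry_operation_rotate_ccw:
  assumes "h > 0" "even h"
  shows "symmetry_operation (2 * h) (rotate_ccw (2 * h))"
proof -
  have "rotate_ccw (2 * h) = prod.swap \<circ> on_rows (reverse_index (2 * h))"
    by (auto simp: rotate_ccw_def on_rows_def reverse_index_def)
  then show ?thesis
    using assms symmetry_operation_comp symmetry_operation_swap symmetry_operation_on_rows
      symmetry_operation_on_columns_reverse by metis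
qed

text \<open>The distance \<open>d\<close> is even and both indices lie in the same half, so halves
  and parities are preserved. It is applied with \<open>d = 2\<close> and
  \<open>d = 4\<close>.\<close>

lemma symmetry_operation_on_columns_transpose:
  assumes "h > 0" "even h" "even d"
    and "1 \<le> i \<and> i + d \<le> h \<or> h + 1 \<le> i \<and> i + d \<le> 2 * h"
  shows "symmetry_operation (2 * h) (on_columns (Transposition.transpose i (i + d)))"
proof (rule symmetry_operation_on_columns[OF assms(1,2)])
  show "respects_halves h (Transposition.transpose i (i + d))"
    unfolding respects_halves_def Transposition.transpose_def image_subset_iff
    using assms(4) by (intro disjI1) auto
  show "respects_parity (2 * h) (Transposition.transpose i (i + d))"
    unfolding respects_parity_def Transposition.transpose_def
    using assms(3) by (intro disjI1) auto
qed simp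

lemma symmetry_operation_on_columns_swap_halves:
  assumes "h > 0" "even h"
  shows "symmetry_operation (2 * h) (on_columns (swap_halves (2 * h)))"
proof (rule symmetry_operation_on_columns[OF assms])
  show "respects_halves h (swap_halves (2 * h))"
    unfolding respects_halves_def swap_halves_def image_subset_iff by (rule disjI2) auto
  show "respects_parity (2 * h) (swap_halves (2 * h))"
    unfolding respects_parity_def swap_halves_def using assms(2) by (intro disjI1) auto
qed (auto simp: swap_halves_def)

text \<open>Since \<open>h\<close> is even, no pair of an odd index and its successor straddles the
  middle; parities are exchanged.\<close>

lemma symmetry_operation_on_columns_swap_adjacent:
  assumes "h > 0" "even h"
  shows "symmetry_operation (2 * h) (on_columns swap_adjacent)"
proof (rule symmetry_operation_on_columns[OF assms])
  have "swap_adjacent j \<in> {1..h}" if "j \<in> {1..h}" for j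
    using that assms(2) unfolding swap_adjacent_def atLeastAtMost_iff by presburger
  moreover have "swap_adjacent j \<in> {h + 1..2 * h}" if "j \<in> {h + 1..2 * h}" for j
    using that assms(2) unfolding swap_adjacent_def atLeastAtMost_iff by presburger
  ultimately show "respects_halves h swap_adjacent"
    unfolding respects_halves_def by blast
  show "respects_parity (2 * h) swap_adjacent"
    by (auto simp: respects_parity_def swap_adjacent_def)
  show "swap_adjacent (swap_adjacent j) = j" if "j \<in> {1..2 * h}" for j
    using that unfolding swap_adjacent_def atLeastAtMost_iff by presburger
qed

theorem theorem1p4p1:
  "(\<forall>n\<in>{8, 16::nat}.
      symmetry_operation n (rotate_cw n) \<and> symmetry_operation n (rotate_ccw n) \<and>
      symmetry_operation n (on_columns (reverse_index n)) \<and>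
      symmetry_operation n (on_rows (reverse_index n)) \<and>
      symmetry_operation n prod.swap \<and>
      (\<forall>i. (1 \<le> i \<and> i \<le> n div 2 - 2) \<or> (n div 2 + 1 \<le> i \<and> i \<le> n - 2) \<longrightarrow>
         symmetry_operation n (on_columns (Transposition.transpose i (i + 2))) \<and>
         symmetry_operation n (on_rows (Transposition.transpose i (i + 2)))) \<and>
      symmetry_operation n (on_columns (swap_halves n)) \<and>
      symmetry_operation n (on_rows (swap_halves n)) \<and>
      symmetry_operation n (on_columns swap_adjacent) \<and>
      symmetry_operation n (on_rows swap_adjacent)) \<and>
   (\<forall>i. (1 \<le> i \<and> i \<le> 4) \<or> (9 \<le> i \<and> i \<le> 12) \<longrightarrow>
      symmetry_operation 16 (on_columns (Transposition.transpose i (i + 4))) \<and>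
      symmetry_operation 16 (on_rows (Transposition.transpose i (i + 4))))"
proof (intro conjI ballI allI impI)
  fix n :: nat assume "n \<in> {8, 16}"
  then obtain h where n: "n = 2 * h" and h: "h > 0" "even h"
    by (auto intro: that[of 4] that[of 8])
  note rows = symmetry_operation_on_rows[OF h]
  show "symmetry_operation n (rotate_cw n)" "symmetry_operation n (rotate_ccw n)"
    "symmetry_operation n prod.swap"
    unfolding n using symmetry_operation_rotate_cw symmetry_operation_rotate_ccw
      symmetry_operation_swap h by blast+
  show "symmetry_operation n (on_columns (reverse_index n))"
    "symmetry_operation n (on_rows (reverse_index n))"
    unfolding n using rows symmetry_operation_on_columns_reverse h by blast+
  show "symmetry_operation n (on_columns (swap_halves n))"
    "symmetry_operation n (on_rows (swap_halves n))"
    unfolding n using rows symmetry_operation_on_columns_swap_halves h by blast+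
  show "symmetry_operation n (on_columns swap_adjacent)"
    "symmetry_operation n (on_rows swap_adjacent)"
    unfolding n using rows symmetry_operation_on_columns_swap_adjacent h by blast+
  fix i assume "1 \<le> i \<and> i \<le> n div 2 - 2 \<or> n div 2 + 1 \<le> i \<and> i \<le> n - 2"
  then have "1 \<le> i \<and> i + 2 \<le> h \<or> h + 1 \<le> i \<and> i + 2 \<le> 2 * h"
    unfolding n by auto
  then show "symmetry_operation n (on_columns (Transposition.transpose i (i + 2)))"
    "symmetry_operation n (on_rows (Transposition.transpose i (i + 2)))"
    unfolding n using rows symmetry_operation_on_columns_transpose[OF h, of 2 i] by simp_all
next
  fix i :: nat assume "1 \<le> i \<and> i \<le> 4 \<or> 9 \<le> i \<and> i \<le> 12"
  \<comment> \<open>With \<open>h = 8\<close> the ranges for \<open>i\<close> say exactly that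
    \<open>i\<close> and \<open>i + 4\<close> lie in the same half.\<close>
  then show "symmetry_operation 16 (on_columns (Transposition.transpose i (i + 4)))"
    using symmetry_operation_on_columns_transpose[of 8 4 i] by auto
  then show "symmetry_operation 16 (on_rows (Transposition.transpose i (i + 4)))"
    using symmetry_operation_on_rows[of 8] by simp
qed

end
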